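(* Let $S_1,\dots,S_n$ be finite subsets of $R$ each satisfying Condition (D) in $R$, and let $(B_a\mid a\in\prod_{i=1}^nS_i)$ be subsets of $\mathbb{N}^n$ such that $\mathbb{N}^n\setminus\nabla(B_a)$ is finite for every $a$. Put $\zeta_1=\sum_{a\in\prod_iS_i}|\mathbb{N}^n\setminus\nabla(B_a)|$ and $$Q=\{f\in\Omega:\ \mathrm{supp}(f(x_1+a_1,\dots,x_n+a_n))\subseteq\nabla(B_a)\text{ for all }a\in\textstyle\prod_{i=1}^nS_i\}.$$ Let $\Lambda$ be a finite set, $(g(\lambda)\mid\lambda\in\Lambda)\in Q^{\Lambda}$ a family of monic polynomials, $\theta(\lambda)$ the greatest element of $\mathrm{supp}(g(\lambda))$, $D=\{\theta(\lambda)\mid\lambda\in\Lambda\}$, with $\mathbb{N}^n\setminus\nabla(D)$ finite, and put $\zeta_2=|\mathbb{N}^n\setminus\nabla(D)|$. Suppose $\zeta_1=\zeta_2$. Then for every $f\in Q$ there exists $(p(\lambda)\mid\lambda\in\Lambda)\in\Omega^\Lambda$ with $f=\sum_{\lambda\in\Lambda}p(\lambda)g(\lambda)$ and $\mathrm{supp}(p(\lambda))+\mathrm{supp}(g(\lambda))\subseteq\Delta(\mathrm{supp}(f))$ for all $\lambda\in\Lambda$. Moreover, for every $\beta\in\max(\mathrm{supp}(f))$ there exists $\lambda\in\Lambda$ with $\theta(\lambda)\leqslant\beta$.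
   Context: Let $R$ be a commutative ring with identity $1_R$, $n$ a positive integer, $\mathbb{N}=\{0,1,2,\dots\}$, $\Omega=R[x_1,\dots,x_n]$. For $\alpha,\beta\in\mathbb{N}^n$, $\alpha\leqslant\beta$ means $\alpha_i\leqslant\beta_i$ for all $i$. For $f\in\Omega$, $f_{[\alpha]}$ is the coefficient of $x_1^{\alpha_1}\cdots x_n^{\alpha_n}$ and $\mathrm{supp}(f)=\{\alpha: f_{[\alpha]}\neq0\}$. For $A,B\subseteq\mathbb{N}^n$: $\Delta(A)=\{\beta:\exists\alpha\in A,\beta\leqslant\alpha\}$, $\nabla(A)=\{\beta:\exists\alpha\in A,\alpha\leqslant\beta\}$, $\max(A)=\{\beta\in A:\forall\alpha\in A,\beta\leqslant\alpha\Rightarrow\beta=\alpha\}$, $A+B=\{\alpha+\beta:\alpha\in A,\beta\in B\}$. A polynomial $g$ is monic if $\mathrm{supp}(g)$ has a greatest element $\theta$ for $\leqslant$ and $g_{[\theta]}=1_R$. A subset $X\subseteq R$ satisfies Condition (D) in $R$ if for all $a\neq b$ in $X$, $b-a$ is not a zero divisor of $R$. *)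

theory Defs
  imports
    "HOL-Library.Poly_Mapping"
    "HOL-Library.Function_Algebras"
    "HOL-Library.Set_Algebras"
    "HOL-Library.FuncSet"
begin

text \<open>
  The index set \<open>{1, \<dots>, n}\<close> is an arbitrary type \<open>'n\<close> of class \<open>finite\<close> (types are nonempty, so
  \<open>n \<ge> 1\<close>), and the ring \<open>R\<close> is the whole type \<open>'a::comm_ring_1\<close>. Exponent vectors are functions
  \<open>'n \<Rightarrow> nat\<close>, whose order \<open>\<le>\<close> and addition are pointwise. Finitely supported functions on them,
  with the convolution product of \<^theory>\<open>HOL-Library.Poly_Mapping\<close>, form the polynomial ring
  \<open>R[x\<^sub>1, \<dots>, x\<^sub>n]\<close>.

  The class \<open>comm_ring_1\<close> excludes only the zero ring, over which there is no monic polynomial.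
\<close>

type_synonym ('n, 'a) mpoly = "('n \<Rightarrow> nat) \<Rightarrow>\<^sub>0 'a"

abbreviation coeff :: "('n, 'a::zero) mpoly \<Rightarrow> ('n \<Rightarrow> nat) \<Rightarrow> 'a" where
  "coeff \<equiv> Poly_Mapping.lookup"

abbreviation supp :: "('n, 'a::zero) mpoly \<Rightarrow> ('n \<Rightarrow> nat) set" where
  "supp \<equiv> Poly_Mapping.keys"

definition Const :: "'a \<Rightarrow> ('n::finite, 'a::comm_ring_1) mpoly" where
  "Const c = Poly_Mapping.single 0 c"

definition Var :: "'n \<Rightarrow> ('n::finite, 'a::comm_ring_1) mpoly" where
  "Var i = Poly_Mapping.single (\<lambda>j. if j = i then 1 else 0) 1"

definition subst_poly ::
    "('n \<Rightarrow> ('n, 'a) mpoly) \<Rightarrow> ('n::finite, 'a::comm_ring_1) mpoly \<Rightarrow> ('n, 'a) mpoly" where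
  "subst_poly h f = (\<Sum>\<alpha>\<in>supp f. Const (coeff f \<alpha>) * (\<Prod>i\<in>UNIV. h i ^ \<alpha> i))"

definition shift_poly ::
    "('n \<Rightarrow> 'a) \<Rightarrow> ('n::finite, 'a::comm_ring_1) mpoly \<Rightarrow> ('n, 'a) mpoly" where
  "shift_poly a = subst_poly (\<lambda>i. Var i + Const (a i))"

definition down_closure :: "('n \<Rightarrow> nat) set \<Rightarrow> ('n \<Rightarrow> nat) set" (\<open>\<Delta>\<close>) where
  "\<Delta> A = {\<beta>. \<exists>\<alpha>\<in>A. \<beta> \<le> \<alpha>}"

definition up_closure :: "('n \<Rightarrow> nat) set \<Rightarrow> ('n \<Rightarrow> nat) set" (\<open>\<nabla>\<close>) where
  "\<nabla> A = {\<beta>. \<exists>\<alpha>\<in>A. \<alpha> \<le> \<beta>}"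

definition maximal_elements :: "('n \<Rightarrow> nat) set \<Rightarrow> ('n \<Rightarrow> nat) set" where
  "maximal_elements A = {\<beta>\<in>A. \<forall>\<alpha>\<in>A. \<beta> \<le> \<alpha> \<longrightarrow> \<beta> = \<alpha>}"

definition monic :: "('n::finite, 'a::comm_ring_1) mpoly \<Rightarrow> bool" where
  "monic g \<longleftrightarrow> (\<exists>\<theta>\<in>supp g. (\<forall>\<alpha>\<in>supp g. \<alpha> \<le> \<theta>) \<and> coeff g \<theta> = 1)"

text \<open>Meaningful only if the support has a greatest element, e.g. for monic polynomials.\<close>

definition greatest_exp :: "('n::finite, 'a::comm_ring_1) mpoly \<Rightarrow> ('n \<Rightarrow> nat)" where
  "greatest_exp g = (GREATEST \<alpha>. \<alpha> \<in> supp g)"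

text \<open>
  Under this definition \<open>0\<close> is a zero divisor. The convention does not affect \<open>condition_D\<close>, where
  only differences of distinct elements occur.
\<close>

definition zero_divisor :: "'a::comm_ring_1 \<Rightarrow> bool" where
  "zero_divisor x \<longleftrightarrow> (\<exists>c. c \<noteq> 0 \<and> x * c = 0)"

definition condition_D :: "'a::comm_ring_1 set \<Rightarrow> bool" where
  "condition_D X \<longleftrightarrow> (\<forall>a\<in>X. \<forall>b\<in>X. a \<noteq> b \<longrightarrow> \<not> zero_divisor (b - a))"

text \<open>The set \<open>Q\<close>; the grid \<open>\<Prod>\<^sub>i S\<^sub>i\<close> is \<open>Pi UNIV S\<close>.\<close>

definition vanishing_set ::
    "('n \<Rightarrow> 'a set) \<Rightarrow> (('n \<Rightarrow> 'a) \<Rightarrow> ('n \<Rightarrow> nat) set) \<Rightarrow> ('n::finite, 'a::comm_ring_1) mpoly set" where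
  "vanishing_set S B = {f. \<forall>a\<in>Pi UNIV S. supp (shift_poly a f) \<subseteq> \<nabla> (B a)}"

end

theory Submission
  imports "Jordan_Normal_Form.Determinant" Defs
begin

text \<open>
  Let \<open>E\<close> be the complement of \<open>\<nabla> D\<close>. Division by the monic polynomials \<open>g l\<close> leaves a remainder
  supported on \<open>E\<close>, which lies in \<open>Q\<close> if the dividend does; so it has to be shown that \<open>0\<close> is the
  only element of \<open>Q\<close> supported on \<open>E\<close>. Membership in \<open>Q\<close> amounts to \<open>\<zeta>\<^sub>1\<close> linear conditions, which on
  polynomials supported on \<open>E\<close> form a square system, with matrix \<open>M\<close>. By Condition (D), for each of
  the conditions some polynomial takes a regular value on it and vanishes on all the others;
  replacing these polynomials by their remainders changes none of the values, and yields a matrix \<open>N\<close>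
  such that \<open>M N\<close> is diagonal with regular diagonal entries. Hence \<open>det M\<close> is regular, and \<open>M\<close> has
  trivial kernel.
\<close>

subsection \<open>Square linear systems with regular determinant\<close>

lemma not_zero_divisor_one: "\<not> zero_divisor (1::'a::comm_ring_1)"
  by (auto simp: zero_divisor_def)

lemma not_zero_divisor_mult:
  "\<not> zero_divisor x \<Longrightarrow> \<not> zero_divisor y \<Longrightarrow> \<not> zero_divisor (x * y)"
  unfolding zero_divisor_def by (metis mult.assoc)

lemma not_zero_divisor_power: "\<not> zero_divisor x \<Longrightarrow> \<not> zero_divisor (x ^ n)"
  by (induction n) (simp_all add: not_zero_divisor_one not_zero_divisor_mult)

lemma not_zero_divisor_prod:
  "(\<And>i. i \<in> I \<Longrightarrow> \<not> zero_divisor (f i)) \<Longrightarrow> \<not> zero_divisor (\<Prod>i\<in>I. f i)"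
  by (induction I rule: infinite_finite_induct)
    (simp_all add: not_zero_divisor_one not_zero_divisor_mult)

text \<open>Enumerating \<open>I\<close> and \<open>J\<close> by the same \<open>{0..<m}\<close>
  turns \<open>M\<close> and \<open>N\<close> into square matrices. Then
  \<open>det M * det N\<close> is the product of the regular elements \<open>d k\<close>, so
  \<open>det M\<close> is regular as a factor of a regular element. Multiplying
  \<open>M v = 0\<close> by the adjugate of \<open>M\<close> gives
  \<open>det M * v j = 0\<close>.\<close>

lemma square_system_trivial_kernel:
  fixes M :: "'i \<Rightarrow> 'j \<Rightarrow> 'a::comm_ring_1"
  assumes "finite I" "finite J" "card I = card J"
    and reg: "\<And>i. i \<in> I \<Longrightarrow> \<not> zero_divisor (d i)"
    and MN: "\<And>i k. i \<in> I \<Longrightarrow> k \<in> I \<Longrightarrow> (\<Sum>j\<in>J. M i j * N j k) = (if i = k then d k else 0)"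
    and Mv: "\<And>i. i \<in> I \<Longrightarrow> (\<Sum>j\<in>J. M i j * v j) = 0"
    and "j \<in> J"
  shows "v j = 0"
proof -
  define m where "m = card I"
  obtain r where r: "bij_betw r {0..<m} I"
    using ex_bij_betw_nat_finite[OF \<open>finite I\<close>] m_def by auto
  obtain s where s: "bij_betw s {0..<m} J"
    using ex_bij_betw_nat_finite[OF \<open>finite J\<close>] m_def \<open>card I = card J\<close> by auto
  define A where "A = mat m m (\<lambda>(i, j). M (r i) (s j))"
  define B where "B = mat m m (\<lambda>(j, k). N (s j) (r k))"
  define w where "w = vec m (\<lambda>j. v (s j))"
  have A: "A \<in> carrier_mat m m" and B: "B \<in> carrier_mat m m" and w: "w \<in> carrier_vec m"
    by (auto simp: A_def B_def w_def)
  have rI: "r i \<in> I" if "i < m" for i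
    using r that by (auto simp: bij_betw_def)
  have r_inj: "r i = r k \<longleftrightarrow> i = k" if "i < m" "k < m" for i k
    using r that by (auto simp: bij_betw_def inj_on_def)
  have reindex: "(\<Sum>j\<in>{0..<m}. F (s j)) = (\<Sum>j\<in>J. F j)" for F :: "'j \<Rightarrow> 'a"
    using s by (rule sum.reindex_bij_betw)
  have AB: "A * B = mat m m (\<lambda>(i, k). if i = k then d (r k) else 0)"
    by (rule eq_matI)
      (auto simp: A_def B_def scalar_prod_def rI r_inj MN reindex[where F = "\<lambda>j. M (r _) j * N j (r _)"])
  have "det (A * B) = (\<Prod>i\<in>{0..<m}. d (r i))"
    unfolding AB by (subst det_upper_triangular[where n = m])
      (auto simp: upper_triangular_def prod_list_diag_prod)
  then have "\<not> zero_divisor (det A * det B)"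
    using det_mult[OF A B] not_zero_divisor_prod[of "{0..<m}" "\<lambda>i. d (r i)"] rI reg by auto
  then have reg_det: "det A * x = 0 \<Longrightarrow> x = 0" for x
    unfolding zero_divisor_def by (metis mult.assoc mult.commute mult_zero_right)
  have Aw: "A *\<^sub>v w = 0\<^sub>v m"
    by (rule eq_vecI)
      (auto simp: A_def w_def scalar_prod_def rI Mv reindex[where F = "\<lambda>j. M (r _) j * v j"])
  have "det A \<cdot>\<^sub>v w = (adj_mat A * A) *\<^sub>v w"
    using w by (auto simp: adj_mat(3)[OF A])
  also have "\<dots> = 0\<^sub>v m"
    using adj_mat(1)[OF A] A w by (subst assoc_mult_mat_vec) (auto simp: Aw)
  finally have w0: "det A \<cdot>\<^sub>v w = 0\<^sub>v m" .
  obtain i where i: "i < m" "j = s i"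
    using s \<open>j \<in> J\<close> by (auto simp: bij_betw_def)
  have "det A * v j = (det A \<cdot>\<^sub>v w) $ i"
    using i by (simp add: w_def)
  then show ?thesis
    using w0 i reg_det by simp
qed

subsection \<open>Polynomials and substitution\<close>

lemma poly_expansion: "f = (\<Sum>\<alpha>\<in>supp f. Poly_Mapping.single \<alpha> (coeff f \<alpha>))"
  by (rule poly_mapping_eqI) (simp add: lookup_sum lookup_single when_def in_keys_iff)

lemma poly_induct [case_names single add]:
  fixes f :: "('n, 'a::comm_monoid_add) mpoly"
  assumes "\<And>\<alpha> c. P (Poly_Mapping.single \<alpha> c)" "\<And>f g. P f \<Longrightarrow> P g \<Longrightarrow> P (f + g)"
  shows "P f"
proof -
  \<comment> \<open>The empty sum is covered by the monomial case with coefficient 0, so no separate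
    case for the zero polynomial arises.\<close>
  have "P (\<Sum>\<alpha>\<in>A. Poly_Mapping.single \<alpha> (coeff f \<alpha>))" if "finite A" for A
    using that assms(1)[of _ 0] by (induction A) (auto intro: assms)
  then show ?thesis
    by (metis poly_expansion finite_keys)
qed

section \<open>Constant polynomials, monomials and constant terms of products\<close>

lemma Const_0 [simp]: "Const 0 = 0"
  by (simp add: Const_def)

lemma Const_1 [simp]: "Const 1 = 1"
  by (simp add: Const_def)

lemma Const_add: "Const (c + d) = Const c + Const d"
  by (simp add: Const_def single_add)

lemma Const_mult: "Const (c * d) = Const c * Const d"
  by (simp add: Const_def mult_single)

lemma Const_power: "Const (c ^ k) = Const c ^ k"
  by (induction k) (auto simp: Const_mult)

text \<open>
  The \<open>induction\<close> method leaves exponent vectors eta-expanded; \<open>plus_fun_apply\<close> and \<open>zero_fun_apply\<close>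
  would rewrite inside them and so hide sums and zeros of exponents from the other rules.
\<close>

lemma coeff_single_mult:
  fixes f :: "('n::finite, 'a::comm_ring_1) mpoly"
  shows "coeff (Poly_Mapping.single \<alpha> c * f) (\<alpha> + \<gamma>) = c * coeff f \<gamma>"
proof (induction f rule: poly_induct)
  case (single \<beta> d)
  then show ?case
    by (simp add: mult_single lookup_single when_def del: plus_fun_apply)
qed (simp add: distrib_left lookup_add del: plus_fun_apply)

lemma coeff_Const_mult: "coeff (Const c * f) \<gamma> = c * coeff f \<gamma>"
  using coeff_single_mult[of 0 c f \<gamma>] by (simp add: Const_def)

text \<open>A sum of exponent vectors over the naturals is 0 only if both are 0. This is evaluation
  at the origin; composed with \<open>shift_poly a\<close> it becomes evaluation at
  \<open>a\<close>.\<close>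

lemma coeff_mult_0:
  fixes f g :: "('n::finite, 'a::comm_ring_1) mpoly"
  shows "coeff (f * g) 0 = coeff f 0 * coeff g 0"
proof (induction f rule: poly_induct)
  case (single \<alpha> c)
  show ?case
  proof (induction g rule: poly_induct)
    case (single \<beta> d)
    have "\<alpha> + \<beta> = 0 \<longleftrightarrow> \<alpha> = 0 \<and> \<beta> = 0"
      by (auto simp: fun_eq_iff)
    then show ?case
      by (auto simp: mult_single lookup_single when_def simp del: zero_fun_apply)
  qed (simp add: distrib_left lookup_add del: zero_fun_apply)
qed (simp add: distrib_right lookup_add del: zero_fun_apply)

lemma coeff_power_0: "coeff (f ^ k) 0 = coeff (f :: ('n::finite, 'a::comm_ring_1) mpoly) 0 ^ k"
  by (induction k) (simp_all add: coeff_mult_0 del: zero_fun_apply)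

lemma coeff_prod_0:
  "coeff (\<Prod>i\<in>I. f i) 0 = (\<Prod>i\<in>I. coeff (f i :: ('n::finite, 'a::comm_ring_1) mpoly) 0)"
  by (induction I rule: infinite_finite_induct) (simp_all add: coeff_mult_0 del: zero_fun_apply)

lemma coeff_Var_0 [simp]: "coeff (Var i) 0 = 0"
  by (auto simp: Var_def lookup_single when_def fun_eq_iff)

lemma coeff_Const_0 [simp]: "coeff (Const c) 0 = c"
  by (simp add: Const_def)

lemma Var_power: "Var i ^ k = Poly_Mapping.single (\<lambda>j. if j = i then k else 0) 1"
proof (induction k)
  case 0
  have "(\<lambda>j. if j = i then 0 else 0) = (0 :: 'a \<Rightarrow> nat)"
    by auto
  then show ?case
    by simp
next
  case (Suc k)
  have "(\<lambda>j. if j = i then 1 else 0) + (\<lambda>j. if j = i then k else 0) = (\<lambda>j. if j = i then Suc k else 0)"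
    by auto
  then show ?case
    using Suc by (simp add: Var_def mult_single)
qed

lemma prod_Var_power: "(\<Prod>i\<in>UNIV. Var i ^ \<beta> i) = Poly_Mapping.single \<beta> 1"
proof -
  have "(\<Prod>i\<in>I. Var i ^ \<beta> i) = Poly_Mapping.single (\<lambda>j. if j \<in> I then \<beta> j else 0) 1"
    if "finite I" for I
    using that
  proof induction
    case empty
    have "(\<lambda>j. 0) = (0 :: 'a \<Rightarrow> nat)"
      by auto
    then show ?case
      by simp
  next
    case (insert i I)
    have "(\<lambda>j. if j = i then \<beta> i else 0) + (\<lambda>j. if j \<in> I then \<beta> j else 0)
        = (\<lambda>j. if j \<in> insert i I then \<beta> j else 0)"
      using insert by auto
    then show ?case
      using insert by (simp add: Var_power mult_single)
  qed
  from this[of UNIV] show ?thesis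
    by simp
qed

section \<open>Supports of products, differences, sums and powers\<close>

lemma supp_mult_up_closure:
  assumes "supp g \<subseteq> \<nabla> A"
  shows "supp (f * g) \<subseteq> \<nabla> A"
proof
  fix \<gamma>
  assume "\<gamma> \<in> supp (f * g)"
  then obtain \<alpha> \<beta> where \<gamma>: "\<gamma> = \<alpha> + \<beta>" and "\<beta> \<in> supp g"
    using keys_mult[of f g] by auto
  then obtain \<delta> where "\<delta> \<in> A" "\<delta> \<le> \<beta>"
    using assms by (auto simp: up_closure_def)
  moreover have "\<beta> \<le> \<gamma>"
    by (simp add: \<gamma> le_fun_def)
  ultimately show "\<gamma> \<in> \<nabla> A"
    unfolding up_closure_def by (blast intro: order_trans)
qed

lemma supp_diff: "supp (f - g :: ('n, 'a::ab_group_add) mpoly) \<subseteq> supp f \<union> supp g"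
  by (auto simp: in_keys_iff lookup_minus)

lemma supp_sum: "supp (\<Sum>i\<in>I. f i) \<subseteq> (\<Union>i\<in>I. supp (f i))"
proof
  fix \<gamma>
  assume "\<gamma> \<in> supp (\<Sum>i\<in>I. f i)"
  then have "(\<Sum>i\<in>I. coeff (f i) \<gamma>) \<noteq> 0"
    by (simp add: in_keys_iff lookup_sum)
  then obtain i where "i \<in> I" "coeff (f i) \<gamma> \<noteq> 0"
    by (rule sum.not_neutral_contains_not_neutral)
  then show "\<gamma> \<in> (\<Union>i\<in>I. supp (f i))"
    by (auto simp: in_keys_iff)
qed

text \<open>Every monomial of \<open>p\<close> has degree at least 1, so each factor
  \<open>p\<close> raises the degree by at least 1. Used with a shifted polynomial, it says that a
  multiple of the \<open>k\<close>-th power of something vanishing at a point vanishes there to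
  order \<open>k\<close>.\<close>

lemma supp_power_mult_degree:
  fixes p q :: "('n::finite, 'a::comm_ring_1) mpoly"
  assumes "coeff p 0 = 0" "\<gamma> \<in> supp (p ^ k * q)"
  shows "k \<le> sum \<gamma> UNIV"
  using assms(2)
proof (induction k arbitrary: \<gamma>)
  case (Suc k)
  then obtain \<alpha> \<beta> where \<gamma>: "\<gamma> = \<alpha> + \<beta>" and "\<alpha> \<in> supp p" "\<beta> \<in> supp (p ^ k * q)"
    using keys_mult[of p "p ^ k * q"] by (auto simp: mult.assoc)
  then have "\<alpha> \<noteq> 0"
    using assms(1) by (auto simp: in_keys_iff)
  then obtain i where "\<alpha> i \<noteq> 0"
    by (auto simp: fun_eq_iff)
  then have "1 \<le> sum \<alpha> UNIV"
    using member_le_sum[of i UNIV \<alpha>] by simp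
  moreover have "k \<le> sum \<beta> UNIV"
    by (rule Suc.IH) fact
  ultimately show ?case
    unfolding \<gamma> plus_fun_apply sum.distrib by linarith
qed simp

section \<open>Substitution as a ring homomorphism\<close>

lemma subst_poly_superset:
  assumes "finite A" "supp f \<subseteq> A"
  shows "subst_poly h f = (\<Sum>\<alpha>\<in>A. Const (coeff f \<alpha>) * (\<Prod>i\<in>UNIV. h i ^ \<alpha> i))"
  unfolding subst_poly_def
  using assms by (intro sum.mono_neutral_left) (auto simp: in_keys_iff)

lemma subst_poly_add: "subst_poly h (f + g) = subst_poly h f + subst_poly h g"
proof -
  \<comment> \<open>\<open>f\<close>, \<open>g\<close> and \<open>f + g\<close> have different
    supports; summing over a common superset makes additivity termwise.\<close>
  have fin: "finite (supp f \<union> supp g)"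
    by simp
  show ?thesis
    unfolding subst_poly_superset[OF fin keys_add] subst_poly_superset[OF fin Un_upper1]
      subst_poly_superset[OF fin Un_upper2]
    by (simp only: lookup_add Const_add distrib_right sum.distrib)
qed

lemma subst_poly_single:
  "subst_poly h (Poly_Mapping.single \<alpha> c) = Const c * (\<Prod>i\<in>UNIV. h i ^ \<alpha> i)"
  by (subst subst_poly_superset[of "{\<alpha>}"]) (auto simp: subset_iff)

lemma subst_poly_mult: "subst_poly h (f * g) = subst_poly h f * subst_poly h g"
proof (induction f rule: poly_induct)
  case (single \<alpha> c)
  show ?case
    by (induction g rule: poly_induct)
      (simp_all add: mult_single subst_poly_single Const_mult power_add prod.distrib
        distrib_left subst_poly_add)
qed (simp add: distrib_right subst_poly_add)

lemma subst_poly_Const: "subst_poly h (Const c) = Const c"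
  unfolding Const_def[of c] by (simp add: subst_poly_single Const_def)

lemma subst_poly_0: "subst_poly h 0 = 0"
  by (simp add: subst_poly_def)

lemma subst_poly_1: "subst_poly h 1 = 1"
  using subst_poly_Const[of h 1] by simp

lemma subst_poly_Var: "subst_poly h (Var i) = h i"
proof -
  have "(\<Prod>j\<in>UNIV. h j ^ (if j = i then 1 else 0)) = (\<Prod>j\<in>UNIV. if j = i then h j else 1)"
    by (rule prod.cong) auto
  then show ?thesis
    by (simp add: Var_def subst_poly_single)
qed

lemma subst_poly_diff: "subst_poly h (f - g) = subst_poly h f - subst_poly h g"
  using subst_poly_add[of h "f - g" g] by (simp add: algebra_simps)

lemma subst_poly_power: "subst_poly h (f ^ k) = subst_poly h f ^ k"
  by (induction k) (auto simp: subst_poly_1 subst_poly_mult)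

lemma subst_poly_prod: "subst_poly h (\<Prod>i\<in>I. f i) = (\<Prod>i\<in>I. subst_poly h (f i))"
  by (induction I rule: infinite_finite_induct) (auto simp: subst_poly_1 subst_poly_mult)

lemma subst_poly_sum: "subst_poly h (\<Sum>i\<in>I. f i) = (\<Sum>i\<in>I. subst_poly h (f i))"
  by (induction I rule: infinite_finite_induct) (auto simp: subst_poly_0 subst_poly_add)

text \<open>Each condition defining \<open>Q\<close> is a linear form in the coefficients of
  \<open>f\<close>. Its values on the monomials are the entries of one row of the linear
  system.\<close>

lemma coeff_shift_poly_linear:
  assumes "finite A" "supp f \<subseteq> A"
  shows "coeff (shift_poly a f) \<beta>
    = (\<Sum>\<alpha>\<in>A. coeff (shift_poly a (Poly_Mapping.single \<alpha> 1)) \<beta> * coeff f \<alpha>)"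
  by (simp add: shift_poly_def subst_poly_superset[OF assms] lookup_sum subst_poly_single
      coeff_Const_mult mult.commute)

subsection \<open>Division by monic polynomials\<close>

lemma monic_greatest_exp:
  assumes "monic g"
  shows "greatest_exp g \<in> supp g"
    and "\<And>\<alpha>. \<alpha> \<in> supp g \<Longrightarrow> \<alpha> \<le> greatest_exp g"
    and "coeff g (greatest_exp g) = 1"
proof -
  obtain \<theta> where \<theta>: "\<theta> \<in> supp g" "\<And>\<alpha>. \<alpha> \<in> supp g \<Longrightarrow> \<alpha> \<le> \<theta>" "coeff g \<theta> = 1"
    using assms by (auto simp: monic_def)
  then have "greatest_exp g = \<theta>"
    unfolding greatest_exp_def by (intro Greatest_equality)
  then show "greatest_exp g \<in> supp g"
    and "\<And>\<alpha>. \<alpha> \<in> supp g \<Longrightarrow> \<alpha> \<le> greatest_exp g"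
    and "coeff g (greatest_exp g) = 1"
    using \<theta> by auto
qed

text \<open>The bound \<open>Z\<close> is a parameter independent of \<open>f\<close>, so that
  divisions with the same bound can be added even when terms of the dividends cancel.\<close>

definition has_division ::
    "'l set \<Rightarrow> ('l \<Rightarrow> ('n::finite, 'a::comm_ring_1) mpoly) \<Rightarrow> ('n \<Rightarrow> nat) set \<Rightarrow> ('n, 'a) mpoly \<Rightarrow> bool"
  where "has_division \<Lambda> g Z f \<longleftrightarrow> (\<exists>p r. f = (\<Sum>l\<in>\<Lambda>. p l * g l) + r \<and>
    (\<forall>l\<in>\<Lambda>. supp (p l) + supp (g l) \<subseteq> Z) \<and>
    supp r \<subseteq> Z - \<nabla> ((\<lambda>l. greatest_exp (g l)) ` \<Lambda>))"

lemma has_division_zero: "has_division \<Lambda> g Z 0"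
  unfolding has_division_def
  by (rule exI[of _ "\<lambda>_. 0"], rule exI[of _ 0]) (auto simp: set_plus_def)

lemma has_division_add:
  assumes "has_division \<Lambda> g Z f" "has_division \<Lambda> g Z f'"
  shows "has_division \<Lambda> g Z (f + f')"
proof -
  obtain p r p' r' where
    *: "f = (\<Sum>l\<in>\<Lambda>. p l * g l) + r" "\<forall>l\<in>\<Lambda>. supp (p l) + supp (g l) \<subseteq> Z"
      "supp r \<subseteq> Z - \<nabla> ((\<lambda>l. greatest_exp (g l)) ` \<Lambda>)"
      "f' = (\<Sum>l\<in>\<Lambda>. p' l * g l) + r'" "\<forall>l\<in>\<Lambda>. supp (p' l) + supp (g l) \<subseteq> Z"
      "supp r' \<subseteq> Z - \<nabla> ((\<lambda>l. greatest_exp (g l)) ` \<Lambda>)"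
    using assms unfolding has_division_def by blast
  show ?thesis
    unfolding has_division_def
  proof (intro exI conjI ballI)
    show "f + f' = (\<Sum>l\<in>\<Lambda>. (p l + p' l) * g l) + (r + r')"
      unfolding *(1,4) by (simp only: distrib_right sum.distrib add.assoc add.commute add.left_commute)
    show "supp (r + r') \<subseteq> Z - \<nabla> ((\<lambda>l. greatest_exp (g l)) ` \<Lambda>)"
      using keys_add *(3,6) by fast
    fix l
    assume "l \<in> \<Lambda>"
    have "supp (p l + p' l) + supp (g l) \<subseteq> (supp (p l) + supp (g l)) \<union> (supp (p' l) + supp (g l))"
      using keys_add[of "p l" "p' l"] unfolding set_plus_def by blast
    then show "supp (p l + p' l) + supp (g l) \<subseteq> Z"
      using *(2,5) \<open>l \<in> \<Lambda>\<close> by blast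
  qed
qed

lemma has_division_sum:
  "(\<And>i. i \<in> I \<Longrightarrow> has_division \<Lambda> g Z (f i)) \<Longrightarrow> has_division \<Lambda> g Z (\<Sum>i\<in>I. f i)"
  by (induction I rule: infinite_finite_induct) (simp_all add: has_division_zero has_division_add)

lemma has_division_mono:
  assumes "has_division \<Lambda> g Z f" "Z \<subseteq> Z'"
  shows "has_division \<Lambda> g Z' f"
  using assms(1) Diff_mono[OF assms(2) order_refl] subset_trans[OF _ assms(2)]
  unfolding has_division_def by (blast intro: subset_trans)

lemma has_division_multiple:
  assumes "finite \<Lambda>" "l \<in> \<Lambda>" "supp p + supp (g l) \<subseteq> Z"
  shows "has_division \<Lambda> g Z (p * g l)"
  unfolding has_division_def
proof (intro exI conjI ballI)
  show "p * g l = (\<Sum>k\<in>\<Lambda>. (if k = l then p else 0) * g k) + 0"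
    using assms(1,2) by (simp add: if_distrib[of "\<lambda>x. x * _"] cong: if_cong)
qed (use assms in \<open>auto simp: set_plus_def\<close>)

lemma down_closure_mono: "\<beta> \<in> \<Delta> A \<Longrightarrow> \<Delta> {\<beta>} \<subseteq> \<Delta> A"
  unfolding down_closure_def by (blast intro: order_trans)

text \<open>Subtracting a multiple of a monic divisor from a reducible monomial leaves monomials of smaller degree.\<close>

lemma has_division_single:
  fixes g :: "'l \<Rightarrow> ('n::finite, 'a::comm_ring_1) mpoly"
  assumes "finite \<Lambda>" "\<And>l. l \<in> \<Lambda> \<Longrightarrow> monic (g l)"
  shows "has_division \<Lambda> g (\<Delta> {\<beta>}) (Poly_Mapping.single \<beta> c)"
proof (induction "sum \<beta> UNIV" arbitrary: \<beta> c rule: less_induct)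
  case less
  show ?case
  proof (cases "\<beta> \<in> \<nabla> ((\<lambda>l. greatest_exp (g l)) ` \<Lambda>)")
    case False
    then have "supp (Poly_Mapping.single \<beta> c) \<subseteq> \<Delta> {\<beta>} - \<nabla> ((\<lambda>l. greatest_exp (g l)) ` \<Lambda>)"
      by (auto simp: down_closure_def)
    then show ?thesis
      unfolding has_division_def
      by (intro exI[of _ "\<lambda>_. 0"] exI[of _ "Poly_Mapping.single \<beta> c"]) (simp add: set_plus_def)
  next
    case True
    then obtain l where l: "l \<in> \<Lambda>" "greatest_exp (g l) \<le> \<beta>"
      by (auto simp: up_closure_def)
    note top = monic_greatest_exp[OF assms(2)[OF l(1)]]
    define \<theta> where "\<theta> = greatest_exp (g l)"
    \<comment> \<open>The truncated subtraction is exact because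
      \<open>\<theta> \<le> \<beta>\<close>.\<close>
    define \<delta> where "\<delta> = (\<lambda>i. \<beta> i - \<theta> i)"
    have \<beta>: "\<beta> = \<delta> + \<theta>"
      using l(2) by (auto simp: \<delta>_def \<theta>_def le_fun_def)
    let ?m = "Poly_Mapping.single \<delta> c"
    have below: "\<delta> + \<alpha> \<le> \<beta>" if "\<alpha> \<in> supp (g l)" for \<alpha>
      using top(2)[OF that] by (auto simp: \<beta> \<theta>_def le_fun_def)
    have "supp ?m + supp (g l) \<subseteq> \<Delta> {\<beta>}"
      using below by (auto simp: set_plus_def down_closure_def split: if_splits)
    then have 1: "has_division \<Lambda> g (\<Delta> {\<beta>}) (?m * g l)"
      using assms(1) l(1) by (intro has_division_multiple)
    define f where "f = Poly_Mapping.single \<beta> c - ?m * g l"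
    \<comment> \<open>The leading coefficient 1 of \<open>g l\<close> makes the monomial at
      \<open>\<beta>\<close> cancel in \<open>f\<close>, without any division in the ring.\<close>
    have "coeff (?m * g l) \<beta> = c"
      using top(3) by (simp add: \<beta> coeff_single_mult \<theta>_def)
    then have "\<beta> \<notin> supp f"
      by (simp add: f_def in_keys_iff lookup_minus)
    moreover have "supp (?m * g l) \<subseteq> {\<gamma>. \<gamma> \<le> \<beta>}"
      using keys_mult[of ?m "g l"] below by (auto split: if_splits)
    then have "supp f \<subseteq> {\<gamma>. \<gamma> \<le> \<beta>}"
      using supp_diff[of "Poly_Mapping.single \<beta> c" "?m * g l"] by (auto simp: f_def split: if_splits)
    ultimately have f_below: "\<gamma> < \<beta>" if "\<gamma> \<in> supp f" for \<gamma>
      using that by (auto simp: order_less_le)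
    have "has_division \<Lambda> g (\<Delta> {\<beta>}) (Poly_Mapping.single \<gamma> (coeff f \<gamma>))" if in_supp: "\<gamma> \<in> supp f" for \<gamma>
    proof (rule has_division_mono)
      \<comment> \<open>A strict inequality of exponent vectors is strict in some component, so the
        total degree drops and the induction hypothesis applies.\<close>
      have le: "\<gamma> \<le> \<beta>" and "\<not> \<beta> \<le> \<gamma>"
        using f_below[OF in_supp] by (simp_all add: less_le_not_le[of \<gamma> \<beta>])
      then obtain i where "\<gamma> i < \<beta> i"
        by (auto simp: le_fun_def not_le)
      with le have "sum \<gamma> UNIV < sum \<beta> UNIV"
        by (intro sum_strict_mono_ex1) (auto simp: le_fun_def)
      then show "has_division \<Lambda> g (\<Delta> {\<gamma>}) (Poly_Mapping.single \<gamma> (coeff f \<gamma>))"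
        by (rule less)
      show "\<Delta> {\<gamma>} \<subseteq> \<Delta> {\<beta>}"
        using le by (intro down_closure_mono) (simp add: down_closure_def)
    qed
    then have "has_division \<Lambda> g (\<Delta> {\<beta>}) f"
      by (subst poly_expansion) (rule has_division_sum)
    with 1 have "has_division \<Lambda> g (\<Delta> {\<beta>}) (?m * g l + f)"
      by (rule has_division_add)
    then show ?thesis
      by (simp add: f_def)
  qed
qed

text \<open>The monomials of \<open>f\<close> are divided one by one. Each division stays below its
  own exponent \<open>\<beta>\<close>, hence inside \<open>\<Delta> (supp f)\<close>.\<close>

lemma has_division_down_closure:
  fixes g :: "'l \<Rightarrow> ('n::finite, 'a::comm_ring_1) mpoly"
  assumes "finite \<Lambda>" "\<And>l. l \<in> \<Lambda> \<Longrightarrow> monic (g l)"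
  shows "has_division \<Lambda> g (\<Delta> (supp f)) f"
proof -
  have "has_division \<Lambda> g (\<Delta> (supp f)) (\<Sum>\<beta>\<in>supp f. Poly_Mapping.single \<beta> (coeff f \<beta>))"
  proof (intro has_division_sum has_division_mono[OF has_division_single])
    show "\<Delta> {\<beta>} \<subseteq> \<Delta> (supp f)" if "\<beta> \<in> supp f" for \<beta>
      using that by (intro down_closure_mono) (auto simp: down_closure_def)
  qed (use assms in auto)
  then show ?thesis
    by (simp flip: poly_expansion)
qed

subsection \<open>Interpolation on the grid\<close>

text \<open>
  \<open>T\<close> vanishes to order \<open>K\<close> at all grid points other than \<open>a\<close>. Writing \<open>c\<close> for the value of \<open>T\<close> at \<open>a\<close>,
  the difference \<open>c ^ K - (c - T) ^ K\<close> is a multiple of \<open>T\<close> that agrees with \<open>c ^ K\<close> at \<open>a\<close> to order \<open>K\<close>.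
\<close>

lemma interpolation_poly:
  fixes S :: "'n::finite \<Rightarrow> 'a::comm_ring_1 set"
  assumes "\<And>i. condition_D (S i)" "a \<in> Pi UNIV S"
    and finite_S: "\<And>i. finite (S i)"
  obtains h c where "\<not> zero_divisor c"
    and "\<And>\<gamma>. sum \<gamma> UNIV < K \<Longrightarrow> coeff (shift_poly a h) \<gamma> = (if \<gamma> = \<beta> then c else 0)"
    and "\<And>a' \<gamma>. a' \<in> Pi UNIV S \<Longrightarrow> a' \<noteq> a \<Longrightarrow> sum \<gamma> UNIV < K \<Longrightarrow> coeff (shift_poly a' h) \<gamma> = 0"
proof -
  define T :: "('n, 'a) mpoly" where "T = (\<Prod>i\<in>UNIV. \<Prod>b\<in>S i - {a i}. (Var i - Const b) ^ K)"
  define c where "c = coeff (shift_poly a T) 0"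
  \<comment> \<open>The shift by \<open>a\<close> turns the first factor into the monomial with
    exponent \<open>\<beta>\<close>. Hence the shifted \<open>h\<close> agrees to order
    \<open>K\<close> with \<open>c ^ K\<close> times that monomial, and the regular element supplied
    at the end is \<open>c ^ K\<close>.\<close>
  define h where
    "h = (\<Prod>i\<in>UNIV. (Var i - Const (a i)) ^ \<beta> i) * (Const (c ^ K) - (Const c - T) ^ K)"
  note shift_simps = shift_poly_def subst_poly_mult subst_poly_prod subst_poly_power
    subst_poly_diff subst_poly_Var subst_poly_Const
  have shift_T: "shift_poly a' T
      = (\<Prod>i\<in>UNIV. \<Prod>b\<in>S i - {a i}. (Var i + Const (a' i) - Const b) ^ K)" for a'
    by (simp add: T_def shift_simps)
  \<comment> \<open>\<open>c\<close> is the value of \<open>T\<close> at \<open>a\<close>, a product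
    of powers of differences of distinct elements of the \<open>S i\<close>, which are regular by
    Condition (D).\<close>
  have "c = (\<Prod>i\<in>UNIV. \<Prod>b\<in>S i - {a i}. (a i - b) ^ K)"
    by (simp only: c_def shift_T coeff_prod_0 coeff_power_0 lookup_minus lookup_add
        coeff_Var_0 coeff_Const_0 add_0_left)
  moreover have "\<not> zero_divisor (a i - b)" if "b \<in> S i - {a i}" for i b
    using assms(1)[of i] assms(2) that unfolding condition_D_def by auto
  ultimately have "\<not> zero_divisor c"
    by (auto intro!: not_zero_divisor_prod not_zero_divisor_power)
  then have "\<not> zero_divisor (c ^ K)"
    by (rule not_zero_divisor_power)
  moreover have "coeff (shift_poly a h) \<gamma> = (if \<gamma> = \<beta> then c ^ K else 0)" if "sum \<gamma> UNIV < K" for \<gamma>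
  proof -
    let ?P = "shift_poly a T"
    have "shift_poly a h = Poly_Mapping.single \<beta> 1 * (Const (c ^ K) - (Const c - ?P) ^ K)"
      by (simp add: h_def shift_simps prod_Var_power)
    then have eq: "shift_poly a h
        = Const (c ^ K) * Poly_Mapping.single \<beta> 1 - (Const c - ?P) ^ K * Poly_Mapping.single \<beta> 1"
      by (simp add: algebra_simps)
    have "coeff (Const c - ?P) 0 = 0"
      unfolding lookup_minus coeff_Const_0 by (simp add: c_def)
    then have "\<gamma> \<notin> supp ((Const c - ?P) ^ K * Poly_Mapping.single \<beta> 1)"
      using supp_power_mult_degree[of "Const c - ?P" \<gamma> K] that leD by blast
    then have "coeff ((Const c - ?P) ^ K * Poly_Mapping.single \<beta> 1) \<gamma> = 0"
      by (simp only: in_keys_iff not_not)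
    then show ?thesis
      by (simp add: eq lookup_minus coeff_Const_mult lookup_single when_def)
  qed
  moreover have "coeff (shift_poly a' h) \<gamma> = 0"
    if "a' \<in> Pi UNIV S" "a' \<noteq> a" "sum \<gamma> UNIV < K" for a' \<gamma>
  proof -
    obtain i where i: "a' i \<noteq> a i"
      using \<open>a' \<noteq> a\<close> by auto
    \<comment> \<open>Since \<open>a' i \<noteq> a i\<close>, the element \<open>b = a' i\<close>
      occurs in the product defining \<open>T\<close>; its factor becomes \<open>Var i ^ K\<close>
      after the shift by \<open>a'\<close>.\<close>
    have "Var i ^ K = (Var i + Const (a' i) - Const (a' i)) ^ K"
      by simp
    also have "\<dots> dvd (\<Prod>b\<in>S i - {a i}. (Var i + Const (a' i) - Const b) ^ K)"
      using finite_S i that(1) by (intro dvd_prodI) auto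
    also have "\<dots> dvd shift_poly a' T"
      unfolding shift_T by (intro dvd_prodI) auto
    also have "\<dots> dvd shift_poly a' h"
    proof -
      \<comment> \<open>A difference of \<open>K\<close>-th powers is divisible by the difference of
        the bases, here \<open>Const c - (Const c - T) = T\<close>.\<close>
      have "Const (c ^ K) - (Const c - T) ^ K
          = T * (\<Sum>j<K. (Const c - T) ^ (K - Suc j) * Const c ^ j)"
        by (simp add: Const_power power_diff_sumr2)
      then have "T dvd h"
        by (simp add: h_def)
      then show ?thesis
        by (auto simp: dvd_def shift_poly_def subst_poly_mult)
    qed
    finally obtain q where "shift_poly a' h = Var i ^ K * q" ..
    moreover have "\<gamma> \<notin> supp (Var i ^ K * q)"
      using supp_power_mult_degree[OF coeff_Var_0, of \<gamma> i K q] that(3) leD by blast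
    ultimately show ?thesis
      by (simp only: in_keys_iff not_not)
  qed
  ultimately show thesis
    by (rule that)
qed

subsection \<open>Reduced polynomials in the vanishing set\<close>

lemma vanishing_set_iff:
  "f \<in> vanishing_set S B
    \<longleftrightarrow> (\<forall>a\<in>Pi UNIV S. \<forall>\<gamma>. \<gamma> \<notin> \<nabla> (B a) \<longrightarrow> coeff (shift_poly a f) \<gamma> = 0)"
  unfolding vanishing_set_def subset_iff in_keys_iff by blast

lemma vanishing_set_diff:
  "f \<in> vanishing_set S B \<Longrightarrow> g \<in> vanishing_set S B \<Longrightarrow> f - g \<in> vanishing_set S B"
  by (simp add: vanishing_set_iff shift_poly_def subst_poly_diff lookup_minus)

text \<open>\<open>Q\<close> is an ideal: shifting is a ring homomorphism, and the polynomials
  supported in an up-closed set are stable under sums and multiples.\<close>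

lemma vanishing_set_combination:
  assumes "\<And>l. l \<in> \<Lambda> \<Longrightarrow> g l \<in> vanishing_set S B"
  shows "(\<Sum>l\<in>\<Lambda>. p l * g l) \<in> vanishing_set S B"
proof -
  have "supp (shift_poly a (p l * g l)) \<subseteq> \<nabla> (B a)" if "l \<in> \<Lambda>" "a \<in> Pi UNIV S" for a l
    unfolding shift_poly_def subst_poly_mult
    using assms[OF that(1)] that(2)
    by (intro supp_mult_up_closure) (simp add: vanishing_set_def shift_poly_def)
  then have "supp (shift_poly a (\<Sum>l\<in>\<Lambda>. p l * g l)) \<subseteq> \<nabla> (B a)" if "a \<in> Pi UNIV S" for a
    unfolding shift_poly_def subst_poly_sum
    by (intro subset_trans[OF supp_sum] UN_least) (use that in auto)
  then show ?thesis
    by (simp add: vanishing_set_def)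
qed

lemma vanishing_set_reduced_eq_0:
  fixes S :: "'n::finite \<Rightarrow> 'a::comm_ring_1 set"
    and g :: "'l \<Rightarrow> ('n, 'a) mpoly"
  assumes finite_S: "\<And>i. finite (S i)"
    and cond_D: "\<And>i. condition_D (S i)"
    and finite_B: "\<And>a. a \<in> Pi UNIV S \<Longrightarrow> finite (UNIV - \<nabla> (B a))"
    and finite_Lambda: "finite \<Lambda>"
    and g_in_Q: "\<And>l. l \<in> \<Lambda> \<Longrightarrow> g l \<in> vanishing_set S B"
    and g_monic: "\<And>l. l \<in> \<Lambda> \<Longrightarrow> monic (g l)"
    and E: "E = UNIV - \<nabla> ((\<lambda>l. greatest_exp (g l)) ` \<Lambda>)"
    and finite_E: "finite E"
    and card_E: "card E = (\<Sum>a\<in>Pi UNIV S. card (UNIV - \<nabla> (B a)))"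
    and r: "r \<in> vanishing_set S B" "supp r \<subseteq> E"
  shows "r = 0"
proof -
  \<comment> \<open>\<open>I\<close> indexes the conditions defining \<open>Q\<close>: a pair of
    \<open>a\<close> and \<open>\<gamma>\<close> stands for the vanishing of the coefficient at
    \<open>\<gamma>\<close> after the shift by \<open>a\<close>.\<close>
  define I where "I = Sigma (Pi UNIV S) (\<lambda>a. UNIV - \<nabla> (B a))"
  have finite_grid: "finite (Pi UNIV S)"
    using finite_PiE[of UNIV S] finite_S by (simp add: PiE_UNIV_domain)
  have finite_I: "finite I"
    unfolding I_def using finite_grid finite_B by (rule finite_SigmaI)
  have card_I: "card I = card E"
    unfolding I_def card_E using finite_grid finite_B by (simp add: card_SigmaI)
  \<comment> \<open>There are finitely many conditions, so one order \<open>K\<close> of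
    interpolation exceeds the degrees of all exponents in them.\<close>
  obtain K where K: "\<And>a \<gamma>. (a, \<gamma>) \<in> I \<Longrightarrow> sum \<gamma> UNIV < K"
  proof -
    have "finite ((\<lambda>(a, \<gamma>). sum \<gamma> UNIV) ` I)"
      using finite_I by simp
    then obtain K where "\<forall>k\<in>(\<lambda>(a, \<gamma>). sum \<gamma> UNIV) ` I. k < K"
      by (auto simp: finite_nat_set_iff_bounded)
    then show thesis
      by (intro that) auto
  qed
  have "\<exists>c q. \<not> zero_divisor c \<and> supp q \<subseteq> E \<and>
      (\<forall>j\<in>I. coeff (shift_poly (fst j) q) (snd j) = (if j = k then c else 0))" if "k \<in> I" for k
  proof -
    obtain a \<beta> where k: "k = (a, \<beta>)" "a \<in> Pi UNIV S"
      using \<open>k \<in> I\<close> by (auto simp: I_def)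
    obtain h c where h: "\<not> zero_divisor c"
      "\<And>\<gamma>. sum \<gamma> UNIV < K \<Longrightarrow> coeff (shift_poly a h) \<gamma> = (if \<gamma> = \<beta> then c else 0)"
      "\<And>a' \<gamma>. a' \<in> Pi UNIV S \<Longrightarrow> a' \<noteq> a \<Longrightarrow> sum \<gamma> UNIV < K \<Longrightarrow> coeff (shift_poly a' h) \<gamma> = 0"
      by (rule interpolation_poly[where S = S and a = a and K = K and \<beta> = \<beta>])
        (use cond_D k(2) finite_S in auto)
    \<comment> \<open>Reduction replaces \<open>h\<close> by a polynomial supported on
      \<open>E\<close>. The difference lies in \<open>Q\<close>, so every condition takes the same
      value on \<open>q\<close> as on \<open>h\<close>.\<close>
    obtain p q where q: "h = (\<Sum>l\<in>\<Lambda>. p l * g l) + q" "supp q \<subseteq> E"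
      using has_division_down_closure[of \<Lambda> g h, OF finite_Lambda g_monic] unfolding has_division_def E by blast
    have "coeff (shift_poly (fst j) q) (snd j) = (if j = k then c else 0)" if "j \<in> I" for j
    proof -
      obtain a' \<gamma> where j: "j = (a', \<gamma>)" "a' \<in> Pi UNIV S" "\<gamma> \<notin> \<nabla> (B a')"
        using \<open>j \<in> I\<close> by (auto simp: I_def)
      have "coeff (shift_poly a' (\<Sum>l\<in>\<Lambda>. p l * g l)) \<gamma> = 0"
        using vanishing_set_combination[of \<Lambda> g S B p, OF g_in_Q] j by (simp add: vanishing_set_iff)
      then have "coeff (shift_poly a' q) \<gamma> = coeff (shift_poly a' h) \<gamma>"
        by (simp add: q(1) shift_poly_def subst_poly_add lookup_add)
      then show ?thesis
        using h(2)[of \<gamma>] h(3)[of a' \<gamma>] K[of a' \<gamma>] that j k by (cases "a' = a") auto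
    qed
    then show ?thesis
      using h(1) q(2) by blast
  qed
  then obtain c q where cq: "\<And>k. k \<in> I \<Longrightarrow> \<not> zero_divisor (c k)"
    "\<And>k. k \<in> I \<Longrightarrow> supp (q k) \<subseteq> E"
    "\<And>j k. k \<in> I \<Longrightarrow> j \<in> I \<Longrightarrow>
      coeff (shift_poly (fst j) (q k)) (snd j) = (if j = k then c k else 0)"
    by metis
  \<comment> \<open>Applied to the coefficients of a polynomial supported on \<open>E\<close>,
    \<open>?M\<close> yields the values of all conditions on it. The columns of \<open>N\<close> are
    the coefficients of the \<open>q k\<close>, so \<open>M N\<close> is diagonal with entries
    \<open>c k\<close>, while \<open>r\<close> gives a vector in the kernel.\<close>
  let ?M = "\<lambda>j \<alpha>. coeff (shift_poly (fst j) (Poly_Mapping.single \<alpha> 1)) (snd j)"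
  have "coeff r \<alpha> = 0" if "\<alpha> \<in> E" for \<alpha>
  proof (rule square_system_trivial_kernel[where M = ?M and N = "\<lambda>\<alpha> k. coeff (q k) \<alpha>" and d = c
        and v = "coeff r", OF finite_I finite_E card_I])
    show "(\<Sum>\<alpha>\<in>E. ?M j \<alpha> * coeff (q k) \<alpha>) = (if j = k then c k else 0)"
      if "j \<in> I" "k \<in> I" for j k
      using coeff_shift_poly_linear[OF finite_E cq(2)[OF that(2)], of "fst j" "snd j"]
        cq(3)[OF that(2,1)] by simp
    show "(\<Sum>\<alpha>\<in>E. ?M j \<alpha> * coeff r \<alpha>) = 0" if "j \<in> I" for j
    proof -
      have "coeff (shift_poly (fst j) r) (snd j) = 0"
        using r(1) that by (auto simp: vanishing_set_iff I_def)
      then show ?thesis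
        using coeff_shift_poly_linear[OF finite_E r(2), of "fst j" "snd j"] by simp
    qed
  qed (use cq(1) that in auto)
  then show "r = 0"
    using r(2) by (intro poly_mapping_eqI) (auto simp: in_keys_iff)
qed

text \<open>A maximal \<open>\<beta>\<close> arises in some product \<open>p l * g l\<close> as
  \<open>\<gamma> + \<delta>\<close>. Replacing \<open>\<delta>\<close> by the greatest exponent of
  \<open>g l\<close> gives an exponent above \<open>\<beta>\<close> that the support bound keeps
  below some element of \<open>supp f\<close>; by maximality this element is
  \<open>\<beta>\<close>.\<close>

lemma maximal_supp_above_greatest_exp:
  fixes g :: "'l \<Rightarrow> ('n::finite, 'a::comm_ring_1) mpoly"
  assumes f: "f = (\<Sum>l\<in>\<Lambda>. p l * g l)"
    and supp: "\<And>l. l \<in> \<Lambda> \<Longrightarrow> supp (p l) + supp (g l) \<subseteq> \<Delta> (supp f)"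
    and monic: "\<And>l. l \<in> \<Lambda> \<Longrightarrow> monic (g l)"
    and \<beta>: "\<beta> \<in> maximal_elements (supp f)"
  shows "\<exists>l\<in>\<Lambda>. greatest_exp (g l) \<le> \<beta>"
proof -
  have "\<beta> \<in> supp (\<Sum>l\<in>\<Lambda>. p l * g l)"
    using \<beta> f by (auto simp: maximal_elements_def)
  then obtain l where l: "l \<in> \<Lambda>" "\<beta> \<in> supp (p l * g l)"
    using supp_sum by blast
  then obtain \<gamma> \<delta> where \<gamma>: "\<beta> = \<gamma> + \<delta>" "\<gamma> \<in> supp (p l)" "\<delta> \<in> supp (g l)"
    using keys_mult by blast
  note top = monic_greatest_exp[OF monic[OF l(1)]]
  have "\<gamma> + greatest_exp (g l) \<in> \<Delta> (supp f)"
    using supp[OF l(1)] \<gamma>(2) top(1) by (blast intro: set_plus_intro)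
  then obtain \<alpha> where \<alpha>: "\<alpha> \<in> supp f" "\<gamma> + greatest_exp (g l) \<le> \<alpha>"
    by (auto simp: down_closure_def)
  have "\<beta> \<le> \<gamma> + greatest_exp (g l)"
    using top(2)[OF \<gamma>(3)] by (simp add: \<gamma>(1) le_fun_def)
  with \<alpha> \<beta> have "\<beta> = \<alpha>"
    by (auto simp: maximal_elements_def)
  moreover have "greatest_exp (g l) \<le> \<gamma> + greatest_exp (g l)"
    by (simp add: le_fun_def)
  ultimately show ?thesis
    using \<alpha>(2) l(1) by (blast intro: order_trans)
qed

theorem theorem4p2:
  fixes S :: "'n::finite \<Rightarrow> 'a::comm_ring_1 set"
    and B :: "('n \<Rightarrow> 'a) \<Rightarrow> ('n \<Rightarrow> nat) set"
    and \<Lambda> :: "'l set"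
    and g :: "'l \<Rightarrow> ('n, 'a) mpoly"
    and D :: "('n \<Rightarrow> nat) set"
    and \<zeta>\<^sub>1 \<zeta>\<^sub>2 :: nat
  assumes finite_S: "\<And>i. finite (S i)"
    and cond_D: "\<And>i. condition_D (S i)"
    and finite_B: "\<And>a. a \<in> Pi UNIV S \<Longrightarrow> finite (UNIV - \<nabla> (B a))"
    and zeta1: "\<zeta>\<^sub>1 = (\<Sum>a\<in>Pi UNIV S. card (UNIV - \<nabla> (B a)))"
    and finite_Lambda: "finite \<Lambda>"
    and g_in_Q: "\<And>l. l \<in> \<Lambda> \<Longrightarrow> g l \<in> vanishing_set S B"
    and g_monic: "\<And>l. l \<in> \<Lambda> \<Longrightarrow> monic (g l)"
    and D: "D = {greatest_exp (g l) | l. l \<in> \<Lambda>}"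
    and finite_D: "finite (UNIV - \<nabla> D)"
    and zeta2: "\<zeta>\<^sub>2 = card (UNIV - \<nabla> D)"
    and zeta_eq: "\<zeta>\<^sub>1 = \<zeta>\<^sub>2"
  shows "\<forall>f\<in>vanishing_set S B.
      (\<exists>p :: 'l \<Rightarrow> ('n, 'a) mpoly.
        f = (\<Sum>l\<in>\<Lambda>. p l * g l) \<and>
        (\<forall>l\<in>\<Lambda>. supp (p l) + supp (g l) \<subseteq> \<Delta> (supp f))) \<and>
      (\<forall>\<beta>\<in>maximal_elements (supp f). \<exists>l\<in>\<Lambda>. greatest_exp (g l) \<le> \<beta>)"
proof (intro ballI)
  fix f
  assume f: "f \<in> vanishing_set S B"
  have D_eq: "D = (\<lambda>l. greatest_exp (g l)) ` \<Lambda>"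
    unfolding D by blast
  obtain p r where pr: "f = (\<Sum>l\<in>\<Lambda>. p l * g l) + r"
    "\<forall>l\<in>\<Lambda>. supp (p l) + supp (g l) \<subseteq> \<Delta> (supp f)" "supp r \<subseteq> UNIV - \<nabla> D"
    using has_division_down_closure[of \<Lambda> g f, OF finite_Lambda g_monic]
    unfolding has_division_def D_eq by blast
  \<comment> \<open>The remainder is a difference of two elements of \<open>Q\<close>, so it is a
    reduced element of \<open>Q\<close> and must vanish.\<close>
  have "r = f - (\<Sum>l\<in>\<Lambda>. p l * g l)"
    by (simp add: pr(1))
  then have "r \<in> vanishing_set S B"
    using vanishing_set_diff[OF f vanishing_set_combination[of \<Lambda> g S B p, OF g_in_Q]] by simp
  moreover have "card (UNIV - \<nabla> D) = (\<Sum>a\<in>Pi UNIV S. card (UNIV - \<nabla> (B a)))"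
    using zeta1 zeta2 zeta_eq by simp
  ultimately have "r = 0"
    using vanishing_set_reduced_eq_0[of S B \<Lambda> g "UNIV - \<nabla> D" r, OF finite_S cond_D finite_B finite_Lambda
        g_in_Q g_monic _ finite_D] pr(3)
    by (simp only: D_eq)
  then have eq: "f = (\<Sum>l\<in>\<Lambda>. p l * g l)"
    using pr(1) by simp
  then have "\<forall>\<beta>\<in>maximal_elements (supp f). \<exists>l\<in>\<Lambda>. greatest_exp (g l) \<le> \<beta>"
    using maximal_supp_above_greatest_exp[of f p g \<Lambda>] g_monic pr(2) by simp
  with eq pr(2) show "(\<exists>p :: 'l \<Rightarrow> ('n, 'a) mpoly.
        f = (\<Sum>l\<in>\<Lambda>. p l * g l) \<and>
        (\<forall>l\<in>\<Lambda>. supp (p l) + supp (g l) \<subseteq> \<Delta> (supp f))) \<and>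
      (\<forall>\<beta>\<in>maximal_elements (supp f). \<exists>l\<in>\<Lambda>. greatest_exp (g l) \<le> \<beta>)"
    by blast
qed

end
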